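(* Let $E$ be a locally convex vector space and let $A=[(A_\varepsilon)_\varepsilon]$, $B=[(B_\varepsilon)_\varepsilon]$ be non-empty internal subsets of $\mathcal G_E$. Then $$[(A_\varepsilon\cup B_\varepsilon)_\varepsilon]=\mathrm{interl}(A\cup B)=\{e_Sa+e_{S^c}b: a\in A,\ b\in B,\ S\subseteq(0,1)\},$$ and this set is the smallest internal set that contains $A\cup B$.
   Context: For a locally convex space $E$ with topology generated by seminorms $(p_i)_{i\in I}$: a net $(u_\varepsilon)_\varepsilon\in E^{(0,1)}$ is moderate if for each $i\in I$ there are $M\in\mathbb N$ and $\eta\in(0,1)$ with $p_i(u_\varepsilon)\le\varepsilon^{-M}$ for all $\varepsilon\le\eta$; it is negligible if for each $i\in I$ and each $m\in\mathbb N$ there is $\eta\in(0,1)$ with $p_i(u_\varepsilon)\le\varepsilon^m$ for all $\varepsilon\le\eta$. The Colombeau space based on $E$ is the quotient $\mathcal G_E$ of the moderate nets by the negligible nets; a net in the class $u\in\mathcal G_E$ is called a representative of $u$. $\widetilde{\mathbb R}=\mathcal G_{\mathbb R}$ is the ring of generalized real numbers, and $\mathcal G_E$ is an $\widetilde{\mathbb R}$-module through $\varepsilon$-wise operations on representatives. For $S\subseteq(0,1)$, $e_S\in\widetilde{\mathbb R}$ is the generalized number with representative $(\chi_S(\varepsilon))_\varepsilon$, where $\chi_S$ is the characteristic function of $S$, and $S^c=(0,1)\setminus S$. A subset $A\subseteq\mathcal G_E$ is internal if there is a net $(A_\varepsilon)_{\varepsilon\in(0,1)}$ of subsets of $E$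 (called a representative of $A$) such that $A=[(A_\varepsilon)_\varepsilon]$, the set of all $u\in\mathcal G_E$ for which there exist a representative $(u_\varepsilon)_\varepsilon$ of $u$ and $\eta>0$ such that $u_\varepsilon\in A_\varepsilon$ for all $\varepsilon<\eta$. For $C\subseteq\mathcal G_E$, $\mathrm{interl}(C)=\{\sum_{j=1}^m e_{S_j}c_j: m\in\mathbb N,\ \{S_1,\dots,S_m\}\text{ a partition of }(0,1),\ c_j\in C\}$. *)

theory Defs
  imports Complex_Main "HOL-Algebra.Module" "HOL-Library.Disjoint_Sets"
    "HOL-Library.Indicator_Function"
begin

section \<open>Locally convex spaces\<close>

definition seminorm :: "('a::real_vector \<Rightarrow> real) \<Rightarrow> bool" where
  "seminorm q \<longleftrightarrow> (\<forall>x y. q (x + y) \<le> q x + q y) \<and> (\<forall>c x. q (c *\<^sub>R x) = \<bar>c\<bar> * q x)"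

text \<open>A locally convex space is a vector space (the whole type) together with a family of
  seminorms; its topology is the one they generate. It is not required to be Hausdorff. A complex
  locally convex space is covered through its underlying real vector space.\<close>

definition locally_convex_space :: "'i set \<Rightarrow> ('i \<Rightarrow> 'a::real_vector \<Rightarrow> real) \<Rightarrow> bool" where
  "locally_convex_space I p \<longleftrightarrow> (\<forall>i\<in>I. seminorm (p i))"


section \<open>Colombeau spaces\<close>

text \<open>A net indexed by the interval \<open>(0,1)\<close> is represented by a function on all reals. No notion
  below depends on its values outside \<open>(0,1)\<close>; in particular nets that agree on \<open>(0,1)\<close> have the
  same class.\<close>

definition moderate :: "'i set \<Rightarrow> ('i \<Rightarrow> 'a::real_vector \<Rightarrow> real) \<Rightarrow> (real \<Rightarrow> 'a) set" where
  "moderate I p =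
    {u. \<forall>i\<in>I. \<exists>M::nat. \<exists>\<eta>\<in>{0<..<1}. \<forall>\<epsilon>\<in>{0<..\<eta>}. p i (u \<epsilon>) \<le> 1 / \<epsilon> ^ M}"

definition negligible :: "'i set \<Rightarrow> ('i \<Rightarrow> 'a::real_vector \<Rightarrow> real) \<Rightarrow> (real \<Rightarrow> 'a) set" where
  "negligible I p =
    {u. \<forall>i\<in>I. \<forall>m::nat. \<exists>\<eta>\<in>{0<..<1}. \<forall>\<epsilon>\<in>{0<..\<eta>}. p i (u \<epsilon>) \<le> \<epsilon> ^ m}"

definition net_rel :: "'i set \<Rightarrow> ('i \<Rightarrow> 'a::real_vector \<Rightarrow> real) \<Rightarrow> ((real \<Rightarrow> 'a) \<times> (real \<Rightarrow> 'a)) set" where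
  "net_rel I p = {(u, v). u \<in> moderate I p \<and> v \<in> moderate I p \<and> (\<lambda>\<epsilon>. u \<epsilon> - v \<epsilon>) \<in> negligible I p}"

definition net_class :: "'i set \<Rightarrow> ('i \<Rightarrow> 'a::real_vector \<Rightarrow> real) \<Rightarrow> (real \<Rightarrow> 'a) \<Rightarrow> (real \<Rightarrow> 'a) set" where
  "net_class I p u = net_rel I p `` {u}"

text \<open>The seminorm family of the real line, indexed by a singleton.\<close>

abbreviation real_seminorms :: "unit \<Rightarrow> real \<Rightarrow> real" where
  "real_seminorms \<equiv> \<lambda>_ x. \<bar>x\<bar>"

abbreviation real_class :: "(real \<Rightarrow> real) \<Rightarrow> (real \<Rightarrow> real) set" where
  "real_class \<equiv> net_class {()} real_seminorms"

text \<open>The elements of the quotients are classes of nets, so a representative of \<open>U\<close> is simply an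
  element of \<open>U\<close>. An operation on classes is the union, over all representatives, of the class of
  the \<open>\<epsilon>\<close>-wise result.\<close>

definition generalized_reals :: "(real \<Rightarrow> real) set ring" where
  "generalized_reals =
    \<lparr>carrier = moderate {()} real_seminorms // net_rel {()} real_seminorms,
     monoid.mult = (\<lambda>U V. \<Union>u\<in>U. \<Union>v\<in>V. real_class (\<lambda>\<epsilon>. u \<epsilon> * v \<epsilon>)),
     one = real_class (\<lambda>_. 1),
     zero = real_class (\<lambda>_. 0),
     add = (\<lambda>U V. \<Union>u\<in>U. \<Union>v\<in>V. real_class (\<lambda>\<epsilon>. u \<epsilon> + v \<epsilon>))\<rparr>"

text \<open>The module record extends the ring record, but the module axioms do not mention its
  multiplicative fields; these are left unspecified.\<close>

definition colombeau ::
  "'i set \<Rightarrow> ('i \<Rightarrow> 'a::real_vector \<Rightarrow> real) \<Rightarrow> ((real \<Rightarrow> real) set, (real \<Rightarrow> 'a) set) module" where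
  "colombeau I p =
    \<lparr>carrier = moderate I p // net_rel I p,
     monoid.mult = undefined,
     one = undefined,
     zero = net_class I p (\<lambda>_. 0),
     add = (\<lambda>U V. \<Union>u\<in>U. \<Union>v\<in>V. net_class I p (\<lambda>\<epsilon>. u \<epsilon> + v \<epsilon>)),
     smult = (\<lambda>R U. \<Union>r\<in>R. \<Union>u\<in>U. net_class I p (\<lambda>\<epsilon>. r \<epsilon> *\<^sub>R u \<epsilon>))\<rparr>"

definition e_gen :: "real set \<Rightarrow> (real \<Rightarrow> real) set" where
  "e_gen S = real_class (indicator S)"


section \<open>Internal sets and interleaving\<close>

definition internal_of ::
  "'i set \<Rightarrow> ('i \<Rightarrow> 'a::real_vector \<Rightarrow> real) \<Rightarrow> (real \<Rightarrow> 'a set) \<Rightarrow> (real \<Rightarrow> 'a) set set" where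
  "internal_of I p A =
    {U \<in> carrier (colombeau I p). \<exists>u\<in>U. \<exists>\<eta>>0. \<forall>\<epsilon>\<in>{0<..<1}. \<epsilon> < \<eta> \<longrightarrow> u \<epsilon> \<in> A \<epsilon>}"

definition internal ::
  "'i set \<Rightarrow> ('i \<Rightarrow> 'a::real_vector \<Rightarrow> real) \<Rightarrow> (real \<Rightarrow> 'a) set set \<Rightarrow> bool" where
  "internal I p X \<longleftrightarrow> (\<exists>A. X = internal_of I p A)"

definition interl ::
  "'i set \<Rightarrow> ('i \<Rightarrow> 'a::real_vector \<Rightarrow> real) \<Rightarrow> (real \<Rightarrow> 'a) set set \<Rightarrow> (real \<Rightarrow> 'a) set set" where
  "interl I p C =
    {\<Oplus>\<^bsub>colombeau I p\<^esub>j\<in>{1..m}. e_gen (S j) \<odot>\<^bsub>colombeau I p\<^esub> c j | (m::nat) S c.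
      inj_on S {1..m} \<and> partition_on {0<..<1} (S ` {1..m}) \<and> c ` {1..m} \<subseteq> C}"


section \<open>The Colombeau space is a module over the generalized reals\<close>

lemma ev_iff:
  "(\<exists>\<eta>\<in>{0<..<1}. \<forall>\<epsilon>\<in>{0<..\<eta>}. P \<epsilon>) \<longleftrightarrow> eventually P (at_right (0::real))"
proof
  assume "\<exists>\<eta>\<in>{0<..<1}. \<forall>\<epsilon>\<in>{0<..\<eta>}. P \<epsilon>"
  then show "eventually P (at_right 0)"
    by (force simp: eventually_at_right_field)
next
  assume "eventually P (at_right 0)"
  then obtain b where b: "b > 0" "\<And>y. 0 < y \<Longrightarrow> y < b \<Longrightarrow> P y"
    by (auto simp: eventually_at_right_field)
  define \<eta> where "\<eta> = min b 1 / 2"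
  have "\<eta> \<in> {0<..<1}" "\<eta> < b" using b(1) by (auto simp: \<eta>_def min_def)
  then show "\<exists>\<eta>\<in>{0<..<1}. \<forall>\<epsilon>\<in>{0<..\<eta>}. P \<epsilon>" using b(2) by (intro bexI[of _ \<eta>]) auto
qed

lemma ev_pos: "eventually (\<lambda>\<epsilon>. 0 < \<epsilon> \<and> \<epsilon> < 1 / 2) (at_right (0::real))"
  unfolding eventually_at_right_field by (intro exI[of _ "1/2"]) auto

lemma moderate_iff:
  "u \<in> moderate I p \<longleftrightarrow> (\<forall>i\<in>I. \<exists>M::nat. \<forall>\<^sub>F \<epsilon> in at_right 0. p i (u \<epsilon>) \<le> 1 / \<epsilon> ^ M)"
  by (simp add: moderate_def ev_iff)

lemma negligible_iff:
  "u \<in> negligible I p \<longleftrightarrow> (\<forall>i\<in>I. \<forall>m::nat. \<forall>\<^sub>F \<epsilon> in at_right 0. p i (u \<epsilon>) \<le> \<epsilon> ^ m)"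
  by (simp add: negligible_def ev_iff)

lemma UN2_constant:
  assumes "a \<in> U" "b \<in> V" and eq: "\<And>x y. x \<in> U \<Longrightarrow> y \<in> V \<Longrightarrow> f x y = c"
  shows "(\<Union>x\<in>U. \<Union>y\<in>V. f x y) = c"
proof -
  have "(\<Union>x\<in>U. \<Union>y\<in>V. f x y) = (\<Union>x\<in>U. \<Union>y\<in>V. c)"
    by (intro SUP_cong refl eq)
  then show ?thesis using assms(1,2) by auto
qed

lemma seminorm_triangle: "seminorm q \<Longrightarrow> q (x + y) \<le> q x + q y"
  and seminorm_scale: "seminorm q \<Longrightarrow> q (c *\<^sub>R x) = \<bar>c\<bar> * q x"
  by (auto simp: seminorm_def)

lemma seminorm_minus: "seminorm q \<Longrightarrow> q (- x) = q x"
  using seminorm_scale[of q "-1" x] by simp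

lemma seminorm_zero: "seminorm q \<Longrightarrow> q 0 = 0"
  using seminorm_scale[of q 0 0] by simp

lemma seminorm_nonneg: "seminorm q \<Longrightarrow> 0 \<le> q x"
  using seminorm_triangle[of q x "- x"] by (simp add: seminorm_minus seminorm_zero)

lemma locally_convex_real [simp]: "locally_convex_space {()} real_seminorms"
  by (auto simp: locally_convex_space_def seminorm_def abs_mult)

context
  fixes I :: "'i set" and p :: "'i \<Rightarrow> 'a::real_vector \<Rightarrow> real"
  assumes lcs: "locally_convex_space I p"
begin

lemma sn: "i \<in> I \<Longrightarrow> seminorm (p i)"
  using lcs by (simp add: locally_convex_space_def)

lemma moderate_add:
  assumes "u \<in> moderate I p" "v \<in> moderate I p"
  shows "(\<lambda>\<epsilon>. u \<epsilon> + v \<epsilon>) \<in> moderate I p"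
  unfolding moderate_iff
proof
  fix i assume i: "i \<in> I"
  from assms i obtain M N :: nat where
    M: "\<forall>\<^sub>F \<epsilon> in at_right 0. p i (u \<epsilon>) \<le> 1 / \<epsilon> ^ M" and
    N: "\<forall>\<^sub>F \<epsilon> in at_right 0. p i (v \<epsilon>) \<le> 1 / \<epsilon> ^ N"
    unfolding moderate_iff by blast
  have "\<forall>\<^sub>F \<epsilon> in at_right 0. p i (u \<epsilon> + v \<epsilon>) \<le> 1 / \<epsilon> ^ Suc (max M N)"
    using M N ev_pos
  proof eventually_elim
    case (elim \<epsilon>)
    have "1 / \<epsilon> ^ M \<le> 1 / \<epsilon> ^ max M N" "1 / \<epsilon> ^ N \<le> 1 / \<epsilon> ^ max M N"
      using elim by (auto intro!: divide_left_mono power_decreasing)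
    then have "p i (u \<epsilon> + v \<epsilon>) \<le> 2 * (1 / \<epsilon> ^ max M N)"
      using seminorm_triangle[OF sn[OF i], of "u \<epsilon>" "v \<epsilon>"] elim by linarith
    also have "\<dots> \<le> (1 / \<epsilon>) * (1 / \<epsilon> ^ max M N)"
      using elim by (intro mult_right_mono) (auto simp: field_simps)
    finally show ?case by simp
  qed
  then show "\<exists>M::nat. \<forall>\<^sub>F \<epsilon> in at_right 0. p i (u \<epsilon> + v \<epsilon>) \<le> 1 / \<epsilon> ^ M" by blast
qed

lemma negligible_add:
  assumes "u \<in> negligible I p" "v \<in> negligible I p"
  shows "(\<lambda>\<epsilon>. u \<epsilon> + v \<epsilon>) \<in> negligible I p"
  unfolding negligible_iff
proof (intro ballI allI)
  fix i and m :: nat assume i: "i \<in> I"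
  have u: "\<forall>\<^sub>F \<epsilon> in at_right 0. p i (u \<epsilon>) \<le> \<epsilon> ^ Suc m"
    and v: "\<forall>\<^sub>F \<epsilon> in at_right 0. p i (v \<epsilon>) \<le> \<epsilon> ^ Suc m"
    using assms i unfolding negligible_iff by blast+
  show "\<forall>\<^sub>F \<epsilon> in at_right 0. p i (u \<epsilon> + v \<epsilon>) \<le> \<epsilon> ^ m"
    using u v ev_pos
  proof eventually_elim
    case (elim \<epsilon>)
    have "p i (u \<epsilon> + v \<epsilon>) \<le> (2 * \<epsilon>) * \<epsilon> ^ m"
      using seminorm_triangle[OF sn[OF i], of "u \<epsilon>" "v \<epsilon>"] elim by simp
    also have "\<dots> \<le> 1 * \<epsilon> ^ m"
      using elim by (intro mult_right_mono) auto
    finally show ?case by simp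
  qed
qed

lemma moderate_scale:
  assumes "r \<in> moderate {()} real_seminorms" "u \<in> moderate I p"
  shows "(\<lambda>\<epsilon>. r \<epsilon> *\<^sub>R u \<epsilon>) \<in> moderate I p"
  unfolding moderate_iff
proof
  fix i assume i: "i \<in> I"
  from assms i obtain M N :: nat where
    M: "\<forall>\<^sub>F \<epsilon> in at_right 0. \<bar>r \<epsilon>\<bar> \<le> 1 / \<epsilon> ^ M" and
    N: "\<forall>\<^sub>F \<epsilon> in at_right 0. p i (u \<epsilon>) \<le> 1 / \<epsilon> ^ N"
    unfolding moderate_iff by blast
  have "\<forall>\<^sub>F \<epsilon> in at_right 0. p i (r \<epsilon> *\<^sub>R u \<epsilon>) \<le> 1 / \<epsilon> ^ (M + N)"
    using M N ev_pos
  proof eventually_elim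
    case (elim \<epsilon>)
    have "\<bar>r \<epsilon>\<bar> * p i (u \<epsilon>) \<le> (1 / \<epsilon> ^ M) * (1 / \<epsilon> ^ N)"
      using elim by (intro mult_mono) (auto simp: seminorm_nonneg sn i)
    then show ?case by (simp add: seminorm_scale[OF sn[OF i]] power_add)
  qed
  then show "\<exists>M::nat. \<forall>\<^sub>F \<epsilon> in at_right 0. p i (r \<epsilon> *\<^sub>R u \<epsilon>) \<le> 1 / \<epsilon> ^ M" by blast
qed

lemma negligible_scale1:
  assumes "r \<in> negligible {()} real_seminorms" "u \<in> moderate I p"
  shows "(\<lambda>\<epsilon>. r \<epsilon> *\<^sub>R u \<epsilon>) \<in> negligible I p"
  unfolding negligible_iff
proof (intro ballI allI)
  fix i and m :: nat assume i: "i \<in> I"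
  from assms i obtain N :: nat where
    N: "\<forall>\<^sub>F \<epsilon> in at_right 0. p i (u \<epsilon>) \<le> 1 / \<epsilon> ^ N"
    unfolding moderate_iff by blast
  have M: "\<forall>\<^sub>F \<epsilon> in at_right 0. \<bar>r \<epsilon>\<bar> \<le> \<epsilon> ^ (m + N)"
    using assms unfolding negligible_iff by blast
  show "\<forall>\<^sub>F \<epsilon> in at_right 0. p i (r \<epsilon> *\<^sub>R u \<epsilon>) \<le> \<epsilon> ^ m"
    using M N ev_pos
  proof eventually_elim
    case (elim \<epsilon>)
    have "\<bar>r \<epsilon>\<bar> * p i (u \<epsilon>) \<le> \<epsilon> ^ (m + N) * (1 / \<epsilon> ^ N)"
      using elim by (intro mult_mono) (auto simp: seminorm_nonneg sn i)
    then show ?case using elim by (simp add: seminorm_scale[OF sn[OF i]] power_add)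
  qed
qed

lemma negligible_scale2:
  assumes "r \<in> moderate {()} real_seminorms" "u \<in> negligible I p"
  shows "(\<lambda>\<epsilon>. r \<epsilon> *\<^sub>R u \<epsilon>) \<in> negligible I p"
  unfolding negligible_iff
proof (intro ballI allI)
  fix i and m :: nat assume i: "i \<in> I"
  from assms i obtain N :: nat where
    N: "\<forall>\<^sub>F \<epsilon> in at_right 0. \<bar>r \<epsilon>\<bar> \<le> 1 / \<epsilon> ^ N"
    unfolding moderate_iff by blast
  have M: "\<forall>\<^sub>F \<epsilon> in at_right 0. p i (u \<epsilon>) \<le> \<epsilon> ^ (m + N)"
    using assms i unfolding negligible_iff by blast
  show "\<forall>\<^sub>F \<epsilon> in at_right 0. p i (r \<epsilon> *\<^sub>R u \<epsilon>) \<le> \<epsilon> ^ m"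
    using M N ev_pos
  proof eventually_elim
    case (elim \<epsilon>)
    have "\<bar>r \<epsilon>\<bar> * p i (u \<epsilon>) \<le> (1 / \<epsilon> ^ N) * \<epsilon> ^ (m + N)"
      using elim by (intro mult_mono) (auto simp: seminorm_nonneg sn i)
    then show ?case using elim by (simp add: seminorm_scale[OF sn[OF i]] power_add)
  qed
qed

lemma negligible_zero: "(\<lambda>_. 0) \<in> negligible I p"
  unfolding negligible_iff
  by (auto simp: seminorm_zero sn intro: eventually_mono[OF ev_pos])

lemma moderate_zero: "(\<lambda>_. 0) \<in> moderate I p"
  unfolding moderate_iff
proof
  fix i assume "i \<in> I"
  then show "\<exists>M::nat. \<forall>\<^sub>F \<epsilon> in at_right 0. p i 0 \<le> 1 / \<epsilon> ^ M"
    by (intro exI[of _ 0]) (simp add: seminorm_zero sn)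
qed

lemma moderate_uminus: "u \<in> moderate I p \<Longrightarrow> (\<lambda>\<epsilon>. - u \<epsilon>) \<in> moderate I p"
  by (simp add: moderate_iff seminorm_minus sn)

lemma negligible_uminus: "u \<in> negligible I p \<Longrightarrow> (\<lambda>\<epsilon>. - u \<epsilon>) \<in> negligible I p"
  by (simp add: negligible_iff seminorm_minus sn)

lemma equiv_net_rel: "equiv (moderate I p) (net_rel I p)"
proof (rule equivI)
  show "net_rel I p \<subseteq> moderate I p \<times> moderate I p" by (auto simp: net_rel_def)
  show "refl_on (moderate I p) (net_rel I p)"
    by (auto simp: refl_on_def net_rel_def negligible_zero)
  show "sym (net_rel I p)"
    by (rule symI) (auto simp: net_rel_def dest: negligible_uminus)
  show "trans (net_rel I p)"
  proof (rule transI)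
    fix u v w assume "(u, v) \<in> net_rel I p" "(v, w) \<in> net_rel I p"
    then show "(u, w) \<in> net_rel I p"
      using negligible_add[of "\<lambda>\<epsilon>. u \<epsilon> - v \<epsilon>" "\<lambda>\<epsilon>. v \<epsilon> - w \<epsilon>"] by (auto simp: net_rel_def)
  qed
qed

lemma carrier_colombeau: "carrier (colombeau I p) = net_class I p ` moderate I p"
  by (auto simp: colombeau_def quotient_def net_class_def)

lemma net_class_self: "u \<in> moderate I p \<Longrightarrow> u \<in> net_class I p u"
  unfolding net_class_def by (rule equiv_class_self[OF equiv_net_rel])

lemma net_class_eq: "(u, v) \<in> net_rel I p \<Longrightarrow> net_class I p u = net_class I p v"
  unfolding net_class_def by (rule equiv_class_eq[OF equiv_net_rel])

lemma add_class:
  assumes "u \<in> moderate I p" "v \<in> moderate I p"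
  shows "net_class I p u \<oplus>\<^bsub>colombeau I p\<^esub> net_class I p v = net_class I p (\<lambda>\<epsilon>. u \<epsilon> + v \<epsilon>)"
proof -
  have eq: "net_class I p (\<lambda>\<epsilon>. u' \<epsilon> + v' \<epsilon>) = net_class I p (\<lambda>\<epsilon>. u \<epsilon> + v \<epsilon>)"
    if "u' \<in> net_class I p u" "v' \<in> net_class I p v" for u' v'
  proof (rule net_class_eq[symmetric])
    have "(\<lambda>\<epsilon>. (u \<epsilon> - u' \<epsilon>) + (v \<epsilon> - v' \<epsilon>)) \<in> negligible I p"
      using that by (intro negligible_add) (auto simp: net_class_def net_rel_def)
    then show "((\<lambda>\<epsilon>. u \<epsilon> + v \<epsilon>), (\<lambda>\<epsilon>. u' \<epsilon> + v' \<epsilon>)) \<in> net_rel I p"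
      using that by (auto simp: net_class_def net_rel_def moderate_add algebra_simps)
  qed
  show ?thesis
    unfolding colombeau_def
    by (simp, intro UN2_constant[OF net_class_self net_class_self] eq assms)
qed

lemma smult_class_aux:
  assumes "r \<in> moderate {()} real_seminorms" "u \<in> moderate I p"
    and r': "r' \<in> real_class r" and u': "u' \<in> net_class I p u"
  shows "net_class I p (\<lambda>\<epsilon>. r' \<epsilon> *\<^sub>R u' \<epsilon>) = net_class I p (\<lambda>\<epsilon>. r \<epsilon> *\<^sub>R u \<epsilon>)"
proof (rule net_class_eq[symmetric])
  have m: "r' \<in> moderate {()} real_seminorms" "u' \<in> moderate I p"
    using r' u' by (auto simp: net_class_def net_rel_def)
  have "(\<lambda>\<epsilon>. (r \<epsilon> - r' \<epsilon>) *\<^sub>R u \<epsilon> + r' \<epsilon> *\<^sub>R (u \<epsilon> - u' \<epsilon>)) \<in> negligible I p"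
    using r' u' m by (intro negligible_add negligible_scale1 negligible_scale2)
      (auto simp: net_class_def net_rel_def)
  then show "((\<lambda>\<epsilon>. r \<epsilon> *\<^sub>R u \<epsilon>), (\<lambda>\<epsilon>. r' \<epsilon> *\<^sub>R u' \<epsilon>)) \<in> net_rel I p"
    using assms m by (auto simp: net_rel_def moderate_scale algebra_simps)
qed

end

lemma smult_class:
  assumes "locally_convex_space I p" "r \<in> moderate {()} real_seminorms" "u \<in> moderate I p"
  shows "real_class r \<odot>\<^bsub>colombeau I p\<^esub> net_class I p u = net_class I p (\<lambda>\<epsilon>. r \<epsilon> *\<^sub>R u \<epsilon>)"
  unfolding colombeau_def
  by (simp, intro UN2_constant[OF net_class_self[OF locally_convex_real] net_class_self]
      smult_class_aux assms)

lemma abelian_group_colombeau: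
  assumes lcs: "locally_convex_space I p"
  shows "abelian_group (colombeau I p)"
proof -
  note [simp] = add_class[OF lcs] moderate_add[OF lcs] moderate_zero[OF lcs]
    moderate_uminus[OF lcs] carrier_colombeau[OF lcs]
  have z: "\<zero>\<^bsub>colombeau I p\<^esub> = net_class I p (\<lambda>_. 0)" by (simp add: colombeau_def)
  show ?thesis
  proof (rule abelian_groupI)
    fix U assume "U \<in> carrier (colombeau I p)"
    then obtain u where u: "u \<in> moderate I p" "U = net_class I p u" by auto
    show "\<exists>V\<in>carrier (colombeau I p). V \<oplus>\<^bsub>colombeau I p\<^esub> U = \<zero>\<^bsub>colombeau I p\<^esub>"
      using u by (intro bexI[of _ "net_class I p (\<lambda>\<epsilon>. - u \<epsilon>)"]) (auto simp: z)
  qed (auto simp: z add_ac)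
qed

lemma generalized_reals_eq:
  "carrier generalized_reals = carrier (colombeau {()} real_seminorms)"
  "add generalized_reals = add (colombeau {()} real_seminorms)"
  "zero generalized_reals = zero (colombeau {()} real_seminorms)"
  "one generalized_reals = real_class (\<lambda>_. 1)"
  "monoid.mult generalized_reals = smult (colombeau {()} real_seminorms)"
  by (simp_all add: generalized_reals_def colombeau_def)

lemma moderate_one: "(\<lambda>_. 1) \<in> moderate {()} real_seminorms"
  unfolding moderate_iff by (auto intro: exI[of _ 0])

lemma cring_generalized_reals: "cring generalized_reals"
proof -
  note lcr = locally_convex_real
  interpret A: abelian_group "colombeau {()} real_seminorms"
    by (rule abelian_group_colombeau[OF lcr])
  have grp: "abelian_group generalized_reals"
    by (rule abelian_groupI; unfold generalized_reals_eq)
      (simp_all add: A.a_ac A.add.l_inv_ex)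
  note [simp] = add_class[OF lcr] moderate_add[OF lcr]
    moderate_scale[OF lcr, simplified] smult_class[OF lcr, simplified]
    carrier_colombeau[OF lcr] moderate_one
  have "comm_monoid generalized_reals"
    by (rule comm_monoidI; unfold generalized_reals_eq) (auto simp: mult_ac)
  with grp show ?thesis
    by (rule cringI; unfold generalized_reals_eq) (auto simp: algebra_simps)
qed

lemma module_colombeau:
  assumes lcs: "locally_convex_space I p"
  shows "Module.module generalized_reals (colombeau I p)"
proof -
  note lcr = locally_convex_real
  note [simp] = add_class[OF lcs] moderate_add[OF lcs] add_class[OF lcr] moderate_add[OF lcr]
    moderate_scale[OF lcr, simplified] smult_class[OF lcr, simplified]
    moderate_scale[OF lcs] smult_class[OF lcs]
    carrier_colombeau[OF lcr] carrier_colombeau[OF lcs] moderate_one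
  show ?thesis
    by (rule moduleI[OF cring_generalized_reals abelian_group_colombeau[OF lcs]];
        unfold generalized_reals_eq) (auto simp: scaleR_left_distrib scaleR_right_distrib)
qed

end

theory Submission
  imports Defs
begin

text \<open>
  Membership in an internal set only concerns the behaviour of a representative as \<open>\<epsilon> \<rightarrow> 0\<close>, and
  multiplying by the idempotents \<open>e\<^sub>S\<close> of a finite partition of \<open>(0,1)\<close> glues representatives
  together pointwise: the class \<open>\<Sum>\<^sub>j e\<^sub>S\<^sub>j c\<^sub>j\<close> is represented by the net that at \<open>\<epsilon> \<in> S\<^sub>j\<close> takes the
  value of the representative of \<open>c\<^sub>j\<close>. There are only finitely many \<open>j\<close>, so the smallness
  conditions on \<open>\<epsilon>\<close> can be met simultaneously, and the glued net still lies in the sets that define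
  the internal set. Hence every internal set is closed under interleaving
  (\<open>interl_internal_subset\<close>).

  Conversely, a net \<open>u\<close> with \<open>u \<epsilon> \<in> A \<epsilon> \<union> B \<epsilon>\<close> splits along \<open>S = {\<epsilon>. u \<epsilon> \<in> A \<epsilon>}\<close>: replacing
  its values off \<open>S\<close> by those of a moderate net that eventually lies in \<open>A \<epsilon>\<close> gives \<open>a\<close>, and
  replacing them on \<open>S\<close> by those of one that eventually lies in \<open>B \<epsilon>\<close> gives \<open>b\<close>. Such nets exist
  because \<open>[A]\<close> and \<open>[B]\<close> are non-empty. Thus each element of \<open>[A \<union> B]\<close> is an
  interleaving \<open>e\<^sub>S a + e\<^sub>S\<^sup>c b\<close> (\<open>internal_union_decompose\<close>).

  With \<open>T\<close> the set of these two-piece interleavings, \<open>[A \<union> B] \<subseteq> T \<subseteq> interl ([A] \<union> [B])\<close>; and since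
  \<open>[A] \<union> [B] \<subseteq> X\<close> implies \<open>interl ([A] \<union> [B]) \<subseteq> X\<close> for every internal \<open>X\<close>, taking
  \<open>X = [A \<union> B]\<close> closes the circle of inclusions, while taking \<open>X\<close> arbitrary gives minimality.
\<close>

section \<open>Nets near zero\<close>

lemma eventually_unit_interval: "\<forall>\<^sub>F \<epsilon> in at_right (0::real). \<epsilon> \<in> {0<..<1}"
  by (rule eventually_mono[OF ev_pos]) auto

lemma moderate_indicator: "indicator S \<in> moderate {()} real_seminorms"
  unfolding moderate_iff by (auto intro!: exI[of _ 0] simp: indicator_def)

lemma moderate_indicator_scale:
  assumes "locally_convex_space I p" "u \<in> moderate I p"
  shows "(\<lambda>\<epsilon>. indicator S \<epsilon> *\<^sub>R u \<epsilon>) \<in> moderate I p"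
  using assms by (intro moderate_scale moderate_indicator)

lemma moderate_eventually_cong:
  assumes "u \<in> moderate I p" and "\<forall>\<^sub>F \<epsilon> in at_right 0. u \<epsilon> = v \<epsilon>"
  shows "v \<in> moderate I p"
  unfolding moderate_iff
proof
  fix i assume "i \<in> I"
  with assms(1) obtain M :: nat where "\<forall>\<^sub>F \<epsilon> in at_right 0. p i (u \<epsilon>) \<le> 1 / \<epsilon> ^ M"
    unfolding moderate_iff by blast
  with assms(2) have "\<forall>\<^sub>F \<epsilon> in at_right 0. p i (v \<epsilon>) \<le> 1 / \<epsilon> ^ M"
    by eventually_elim simp
  then show "\<exists>M::nat. \<forall>\<^sub>F \<epsilon> in at_right 0. p i (v \<epsilon>) \<le> 1 / \<epsilon> ^ M" by blast
qed

lemma net_class_eventually_cong: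
  assumes lcs: "locally_convex_space I p" and u: "u \<in> moderate I p"
    and eq: "\<forall>\<^sub>F \<epsilon> in at_right 0. u \<epsilon> = v \<epsilon>"
  shows "net_class I p u = net_class I p v"
proof (rule net_class_eq[OF lcs])
  have "p i (u \<epsilon> - v \<epsilon>) \<le> \<epsilon> ^ m" if "i \<in> I" "u \<epsilon> = v \<epsilon>" "\<epsilon> \<in> {0<..<1}" for i \<epsilon> m
    using that by (simp add: seminorm_zero sn[OF lcs])
  then have "(\<lambda>\<epsilon>. u \<epsilon> - v \<epsilon>) \<in> negligible I p"
    unfolding negligible_iff
    by (auto intro: eventually_mono[OF eventually_conj[OF eq eventually_unit_interval]])
  then show "(u, v) \<in> net_rel I p"
    using u moderate_eventually_cong[OF u eq] by (simp add: net_rel_def)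
qed

text \<open>Which representative witnesses membership matters, because the sets \<open>A \<epsilon>\<close> need not be stable
  under negligible perturbations. Since \<open>U\<close> is the class of any of its representatives, the witness
  may serve as the net that defines \<open>U\<close>.\<close>

lemma internal_of_iff:
  assumes lcs: "locally_convex_space I p"
  shows "U \<in> internal_of I p A \<longleftrightarrow>
    (\<exists>u\<in>moderate I p. U = net_class I p u \<and> (\<forall>\<^sub>F \<epsilon> in at_right 0. u \<epsilon> \<in> A \<epsilon>))"
proof -
  have ev: "(\<exists>\<eta>>0. \<forall>\<epsilon>\<in>{0<..<1}. \<epsilon> < \<eta> \<longrightarrow> u \<epsilon> \<in> A \<epsilon>) \<longleftrightarrow> (\<forall>\<^sub>F \<epsilon> in at_right 0. u \<epsilon> \<in> A \<epsilon>)" for u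
  proof
    assume "\<exists>\<eta>>0. \<forall>\<epsilon>\<in>{0<..<1}. \<epsilon> < \<eta> \<longrightarrow> u \<epsilon> \<in> A \<epsilon>"
    then obtain \<eta> where "\<eta> > 0" "\<forall>\<epsilon>\<in>{0<..<1}. \<epsilon> < \<eta> \<longrightarrow> u \<epsilon> \<in> A \<epsilon>" by blast
    then show "\<forall>\<^sub>F \<epsilon> in at_right 0. u \<epsilon> \<in> A \<epsilon>"
      unfolding eventually_at_right_field by (intro exI[of _ "min \<eta> 1"]) auto
  qed (auto simp: eventually_at_right_field)
  have rep: "U \<in> carrier (colombeau I p) \<and> u \<in> U \<longleftrightarrow> u \<in> moderate I p \<and> U = net_class I p u" for u
    using net_class_eq[OF lcs] net_class_self[OF lcs]
    by (auto simp: carrier_colombeau[OF lcs] net_class_def net_rel_def)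
  show ?thesis
    unfolding internal_of_def ev using rep by blast
qed

section \<open>Internal sets are closed under interleaving\<close>

text \<open>This reduces interleavings to nets: when the \<open>S j\<close> partition \<open>(0,1)\<close>, at each \<open>\<epsilon>\<close> a single
  summand survives, so the pointwise sum is the net glued from the \<open>v j\<close>.\<close>

lemma finsum_e_gen:
  assumes lcs: "locally_convex_space I p" and "finite J"
    and "\<And>j. j \<in> J \<Longrightarrow> v j \<in> moderate I p \<and> c j = net_class I p (v j)"
  shows "(\<lambda>\<epsilon>. \<Sum>j\<in>J. indicator (S j) \<epsilon> *\<^sub>R v j \<epsilon>) \<in> moderate I p \<and>
    (\<Oplus>\<^bsub>colombeau I p\<^esub>j\<in>J. e_gen (S j) \<odot>\<^bsub>colombeau I p\<^esub> c j) =
      net_class I p (\<lambda>\<epsilon>. \<Sum>j\<in>J. indicator (S j) \<epsilon> *\<^sub>R v j \<epsilon>)"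
proof -
  interpret abelian_group "colombeau I p" by (rule abelian_group_colombeau[OF lcs])
  from assms(2,3) show ?thesis
  proof (induction J)
    case empty
    show ?case by (simp add: moderate_zero[OF lcs]) (simp add: colombeau_def)
  next
    case (insert k J)
    have scaled: "e_gen (S j) \<odot>\<^bsub>colombeau I p\<^esub> c j = net_class I p (\<lambda>\<epsilon>. indicator (S j) \<epsilon> *\<^sub>R v j \<epsilon>)"
      and modr: "(\<lambda>\<epsilon>. indicator (S j) \<epsilon> *\<^sub>R v j \<epsilon>) \<in> moderate I p"
      if "j \<in> insert k J" for j
      using insert.prems[OF that]
      by (simp_all add: e_gen_def smult_class[OF lcs moderate_indicator]
          moderate_indicator_scale[OF lcs])
    have carr: "e_gen (S j) \<odot>\<^bsub>colombeau I p\<^esub> c j \<in> carrier (colombeau I p)"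
      if "j \<in> insert k J" for j
      using scaled[OF that] modr[OF that] by (simp add: carrier_colombeau[OF lcs])
    have IH: "(\<lambda>\<epsilon>. \<Sum>j\<in>J. indicator (S j) \<epsilon> *\<^sub>R v j \<epsilon>) \<in> moderate I p"
      "(\<Oplus>\<^bsub>colombeau I p\<^esub>j\<in>J. e_gen (S j) \<odot>\<^bsub>colombeau I p\<^esub> c j) =
        net_class I p (\<lambda>\<epsilon>. \<Sum>j\<in>J. indicator (S j) \<epsilon> *\<^sub>R v j \<epsilon>)"
      using insert.IH insert.prems by auto
    have "(\<Oplus>\<^bsub>colombeau I p\<^esub>j\<in>insert k J. e_gen (S j) \<odot>\<^bsub>colombeau I p\<^esub> c j) =
        e_gen (S k) \<odot>\<^bsub>colombeau I p\<^esub> c k \<oplus>\<^bsub>colombeau I p\<^esub>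
        (\<Oplus>\<^bsub>colombeau I p\<^esub>j\<in>J. e_gen (S j) \<odot>\<^bsub>colombeau I p\<^esub> c j)"
      using insert.hyps carr by (intro finsum_insert) auto
    then show ?case
      using insert.hyps IH scaled[of k] modr[of k]
      by (simp add: add_class[OF lcs] moderate_add[OF lcs] del: sum_indicator_scaleR)
  qed
qed

lemma interl_internal_subset:
  assumes lcs: "locally_convex_space I p" and C: "C \<subseteq> internal_of I p X"
  shows "interl I p C \<subseteq> internal_of I p X"
proof
  fix U assume "U \<in> interl I p C"
  then obtain m :: nat and S c where
    U: "U = (\<Oplus>\<^bsub>colombeau I p\<^esub>j\<in>{1..m}. e_gen (S j) \<odot>\<^bsub>colombeau I p\<^esub> c j)"
    and inj: "inj_on S {1..m}" and part: "partition_on {0<..<1} (S ` {1..m})"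
    and c: "c ` {1..m} \<subseteq> C"
    unfolding interl_def by blast
  have "\<forall>j\<in>{1..m}. \<exists>u\<in>moderate I p. c j = net_class I p u \<and> (\<forall>\<^sub>F \<epsilon> in at_right 0. u \<epsilon> \<in> X \<epsilon>)"
    using c C internal_of_iff[OF lcs] by blast
  then obtain v where v: "\<And>j. j \<in> {1..m} \<Longrightarrow> v j \<in> moderate I p \<and> c j = net_class I p (v j)"
    and vX: "\<And>j. j \<in> {1..m} \<Longrightarrow> \<forall>\<^sub>F \<epsilon> in at_right 0. v j \<epsilon> \<in> X \<epsilon>"
    by metis
  define w where "w \<epsilon> = (\<Sum>j\<in>{1..m}. indicator (S j) \<epsilon> *\<^sub>R v j \<epsilon>)" for \<epsilon>
  have w: "w \<in> moderate I p" "U = net_class I p w"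
    using finsum_e_gen[where J = "{1..m}" and v = v and c = c and S = S, OF lcs finite_atLeastAtMost v] U
    unfolding w_def[abs_def] by auto
  have glue: "\<exists>k\<in>{1..m}. w \<epsilon> = v k \<epsilon>" if "\<epsilon> \<in> {0<..<1}" for \<epsilon>
  proof -
    have "\<epsilon> \<in> (\<Union>j\<in>{1..m}. S j)"
      using that part by (simp only: partition_on_def)
    then obtain k where k: "k \<in> {1..m}" "\<epsilon> \<in> S k" by blast
    have "\<epsilon> \<notin> S j" if j: "j \<in> {1..m}" "j \<noteq> k" for j
    proof -
      \<comment> \<open>Injectivity turns distinct indices into distinct, hence disjoint, blocks.\<close>
      have "S j \<noteq> S k" using inj j k by (auto dest: inj_onD)
      then have "S j \<inter> S k = {}"
        using part j k by (intro disjointD[OF partition_onD2[OF part]]) blast+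
      then show ?thesis using k by auto
    qed
    then have "w \<epsilon> = (\<Sum>j\<in>{1..m}. if j = k then v k \<epsilon> else 0)"
      unfolding w_def using k by (intro sum.cong) auto
    then have "w \<epsilon> = v k \<epsilon>" using k by simp
    then show ?thesis using k by blast
  qed
  have "\<forall>\<^sub>F \<epsilon> in at_right 0. \<forall>j\<in>{1..m}. v j \<epsilon> \<in> X \<epsilon>"
    using vX by (intro eventually_ball_finite) auto
  with eventually_unit_interval have "\<forall>\<^sub>F \<epsilon> in at_right 0. w \<epsilon> \<in> X \<epsilon>"
    by eventually_elim (use glue in force)
  with w show "U \<in> internal_of I p X"
    unfolding internal_of_iff[OF lcs] by blast
qed

section \<open>Two-piece interleavings\<close>

text \<open>The two sides are given by nets that agree on \<open>(0,1)\<close> but possibly not outside it, where the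
  indicator of \<open>(0,1) - S\<close> vanishes; equality of the classes only sees small positive \<open>\<epsilon>\<close>.\<close>

lemma e_gen_pair:
  assumes lcs: "locally_convex_space I p"
    and "u \<in> moderate I p" "v \<in> moderate I p"
  shows "e_gen S \<odot>\<^bsub>colombeau I p\<^esub> net_class I p u \<oplus>\<^bsub>colombeau I p\<^esub>
      e_gen ({0<..<1} - S) \<odot>\<^bsub>colombeau I p\<^esub> net_class I p v =
    net_class I p (\<lambda>\<epsilon>. if \<epsilon> \<in> S then u \<epsilon> else v \<epsilon>)"
    and "(\<lambda>\<epsilon>. if \<epsilon> \<in> S then u \<epsilon> else v \<epsilon>) \<in> moderate I p"
proof -
  let ?w = "\<lambda>\<epsilon>. indicator S \<epsilon> *\<^sub>R u \<epsilon> + indicator ({0<..<1} - S) \<epsilon> *\<^sub>R v \<epsilon>"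
  have w: "?w \<in> moderate I p"
    using assms by (intro moderate_add moderate_indicator_scale)
  have eq: "\<forall>\<^sub>F \<epsilon> in at_right 0. ?w \<epsilon> = (if \<epsilon> \<in> S then u \<epsilon> else v \<epsilon>)"
    using eventually_unit_interval by eventually_elim (auto simp: indicator_def)
  show "(\<lambda>\<epsilon>. if \<epsilon> \<in> S then u \<epsilon> else v \<epsilon>) \<in> moderate I p"
    by (rule moderate_eventually_cong[OF w eq])
  show "e_gen S \<odot>\<^bsub>colombeau I p\<^esub> net_class I p u \<oplus>\<^bsub>colombeau I p\<^esub>
      e_gen ({0<..<1} - S) \<odot>\<^bsub>colombeau I p\<^esub> net_class I p v =
    net_class I p (\<lambda>\<epsilon>. if \<epsilon> \<in> S then u \<epsilon> else v \<epsilon>)"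
    using assms net_class_eventually_cong[OF lcs w eq]
    by (simp add: e_gen_def smult_class[OF lcs moderate_indicator]
        moderate_indicator_scale[OF lcs] add_class[OF lcs])
qed

text \<open>The blocks of a partition must be non-empty, so for \<open>S = \<emptyset>\<close> and \<open>S = (0,1)\<close> the two-piece
  sum is not of the required form as it stands. In these cases it equals \<open>b\<close> or \<open>a\<close>, which is an
  interleaving along the one-block partition.\<close>

lemma e_gen_pair_in_interl:
  assumes lcs: "locally_convex_space I p" and S: "S \<subseteq> {0<..<1}"
    and ab: "a \<in> C" "b \<in> C" and C: "C \<subseteq> carrier (colombeau I p)"
  shows "e_gen S \<odot>\<^bsub>colombeau I p\<^esub> a \<oplus>\<^bsub>colombeau I p\<^esub> e_gen ({0<..<1} - S) \<odot>\<^bsub>colombeau I p\<^esub> b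
    \<in> interl I p C"
proof -
  interpret abelian_group "colombeau I p" by (rule abelian_group_colombeau[OF lcs])
  obtain u v where u: "u \<in> moderate I p" "a = net_class I p u"
    and v: "v \<in> moderate I p" "b = net_class I p v"
    using ab C unfolding carrier_colombeau[OF lcs] by blast
  have smult: "e_gen T \<odot>\<^bsub>colombeau I p\<^esub> x \<in> carrier (colombeau I p)" if "x \<in> C" for T x
    using that C
    by (auto simp: e_gen_def carrier_colombeau[OF lcs] smult_class[OF lcs moderate_indicator]
        intro!: imageI moderate_indicator_scale[OF lcs])
  have one: "x \<in> interl I p C" if x: "x \<in> C" for x
  proof -
    obtain z where z: "z \<in> moderate I p" "x = net_class I p z"
      using x C unfolding carrier_colombeau[OF lcs] by blast
    have eq: "\<forall>\<^sub>F \<epsilon> in at_right 0. indicator {0<..<1} \<epsilon> *\<^sub>R z \<epsilon> = z \<epsilon>"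
      using eventually_unit_interval by eventually_elim simp
    have "x = e_gen {0<..<1} \<odot>\<^bsub>colombeau I p\<^esub> x"
      using z net_class_eventually_cong[OF lcs moderate_indicator_scale[OF lcs z(1)] eq]
      by (simp add: e_gen_def smult_class[OF lcs moderate_indicator])
    then have "x = (\<Oplus>\<^bsub>colombeau I p\<^esub>j\<in>{1..1::nat}. e_gen {0<..<1} \<odot>\<^bsub>colombeau I p\<^esub> x)"
      using x C by (simp add: subset_iff)
    then show ?thesis
      unfolding interl_def using x
      by (intro CollectI exI[of _ "1::nat"] exI[of _ "\<lambda>_. {0<..<1}"] exI[of _ "\<lambda>_. x"])
        (auto simp: partition_on_def)
  qed
  consider "S = {}" | "S = {0<..<1}" | "S \<noteq> {}" "{0<..<1} - S \<noteq> {}" using S by blast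
  then show ?thesis
  proof cases
    case 1
    then show ?thesis using e_gen_pair(1)[OF lcs u(1) v(1), of S] one[OF ab(2)] u v by simp
  next
    case 2
    have "\<forall>\<^sub>F \<epsilon> in at_right 0. (if \<epsilon> \<in> S then u \<epsilon> else v \<epsilon>) = u \<epsilon>"
      unfolding 2 using eventually_unit_interval by eventually_elim simp
    from net_class_eventually_cong[OF lcs e_gen_pair(2)[OF lcs u(1) v(1)] this]
    show ?thesis using e_gen_pair(1)[OF lcs u(1) v(1), of S] one[OF ab(1)] u v by simp
  next
    case 3
    define T where "T j = (if j = (1::nat) then S else {0<..<1} - S)" for j
    define c where "c j = (if j = (1::nat) then a else b)" for j
    have two: "{1..2} = {1, 2::nat}" by auto
    have "e_gen S \<odot>\<^bsub>colombeau I p\<^esub> a \<oplus>\<^bsub>colombeau I p\<^esub> e_gen ({0<..<1} - S) \<odot>\<^bsub>colombeau I p\<^esub> b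
      = (\<Oplus>\<^bsub>colombeau I p\<^esub>j\<in>{1..2::nat}. e_gen (T j) \<odot>\<^bsub>colombeau I p\<^esub> c j)"
      unfolding two using smult ab by (simp add: T_def c_def)
    moreover have "inj_on T {1..2}" "partition_on {0<..<1} (T ` {1..2})" "c ` {1..2} \<subseteq> C"
      using 3 S ab unfolding two by (auto simp: T_def c_def partition_on_def disjoint_def)
    ultimately show ?thesis unfolding interl_def by blast
  qed
qed

section \<open>Internal sets of unions\<close>

lemma internal_of_mono:
  assumes "\<And>\<epsilon>. A \<epsilon> \<subseteq> B \<epsilon>"
  shows "internal_of I p A \<subseteq> internal_of I p B"
  unfolding internal_of_def using assms by blast

text \<open>Splitting along \<open>S = {\<epsilon>. u \<epsilon> \<in> A \<epsilon>}\<close> leaves \<open>u\<close> in \<open>B \<epsilon>\<close> off \<open>S\<close> for small \<open>\<epsilon>\<close>. To turn the two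
  halves into elements of the internal sets, the gaps are filled with nets that are already known
  to lie in \<open>A\<close> and \<open>B\<close>; gluing along \<open>S\<close> discards the fillers and returns \<open>u\<close>.\<close>

lemma internal_union_decompose:
  assumes lcs: "locally_convex_space I p"
    and ne: "internal_of I p A \<noteq> {}" "internal_of I p B \<noteq> {}"
    and U: "U \<in> internal_of I p (\<lambda>\<epsilon>. A \<epsilon> \<union> B \<epsilon>)"
  obtains S a b where "S \<subseteq> {0<..<1}" "a \<in> internal_of I p A" "b \<in> internal_of I p B"
    "U = e_gen S \<odot>\<^bsub>colombeau I p\<^esub> a \<oplus>\<^bsub>colombeau I p\<^esub> e_gen ({0<..<1} - S) \<odot>\<^bsub>colombeau I p\<^esub> b"
proof -
  obtain u where u: "u \<in> moderate I p" "U = net_class I p u"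
    "\<forall>\<^sub>F \<epsilon> in at_right 0. u \<epsilon> \<in> A \<epsilon> \<union> B \<epsilon>"
    using U unfolding internal_of_iff[OF lcs] by blast
  obtain a where a: "a \<in> moderate I p" "\<forall>\<^sub>F \<epsilon> in at_right 0. a \<epsilon> \<in> A \<epsilon>"
    using ne(1) by (auto simp: ex_in_conv[symmetric] internal_of_iff[OF lcs])
  obtain b where b: "b \<in> moderate I p" "\<forall>\<^sub>F \<epsilon> in at_right 0. b \<epsilon> \<in> B \<epsilon>"
    using ne(2) by (auto simp: ex_in_conv[symmetric] internal_of_iff[OF lcs])
  define S where "S = {\<epsilon>\<in>{0<..<1}. u \<epsilon> \<in> A \<epsilon>}"
  let ?a = "\<lambda>\<epsilon>. if \<epsilon> \<in> S then u \<epsilon> else a \<epsilon>" and ?b = "\<lambda>\<epsilon>. if \<epsilon> \<in> S then b \<epsilon> else u \<epsilon>"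
  note modr = e_gen_pair(2)[OF lcs u(1) a(1), of S] e_gen_pair(2)[OF lcs b(1) u(1), of S]
  have "\<forall>\<^sub>F \<epsilon> in at_right 0. ?a \<epsilon> \<in> A \<epsilon>"
    using a(2) by eventually_elim (auto simp: S_def)
  moreover have "\<forall>\<^sub>F \<epsilon> in at_right 0. ?b \<epsilon> \<in> B \<epsilon>"
    using b(2) u(3) eventually_unit_interval by eventually_elim (auto simp: S_def)
  moreover have "(\<lambda>\<epsilon>. if \<epsilon> \<in> S then ?a \<epsilon> else ?b \<epsilon>) = u" by auto
  ultimately show thesis
    using modr u(2) e_gen_pair(1)[OF lcs modr, of S]
    by (intro that[of S "net_class I p ?a" "net_class I p ?b"])
      (auto simp: internal_of_iff[OF lcs] S_def)
qed

theorem theorem3p7: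
  fixes I :: "'i set" and p :: "'i \<Rightarrow> 'a::real_vector \<Rightarrow> real"
    and Anet Bnet :: "real \<Rightarrow> 'a set" and A B D :: "(real \<Rightarrow> 'a) set set"
  assumes "locally_convex_space I p"
    and "A = internal_of I p Anet" and "A \<noteq> {}"
    and "B = internal_of I p Bnet" and "B \<noteq> {}"
    and "D = internal_of I p (\<lambda>\<epsilon>. Anet \<epsilon> \<union> Bnet \<epsilon>)"
  shows "D = interl I p (A \<union> B) \<and>
    interl I p (A \<union> B) =
      {e_gen S \<odot>\<^bsub>colombeau I p\<^esub> a \<oplus>\<^bsub>colombeau I p\<^esub> e_gen ({0<..<1} - S) \<odot>\<^bsub>colombeau I p\<^esub> b
        | S a b. a \<in> A \<and> b \<in> B \<and> S \<subseteq> {0<..<1}} \<and>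
    (internal I p D \<and> A \<union> B \<subseteq> D \<and> (\<forall>X. internal I p X \<and> A \<union> B \<subseteq> X \<longrightarrow> D \<subseteq> X))"
proof -
  note lcs = assms(1)
  let ?T = "{e_gen S \<odot>\<^bsub>colombeau I p\<^esub> a \<oplus>\<^bsub>colombeau I p\<^esub> e_gen ({0<..<1} - S) \<odot>\<^bsub>colombeau I p\<^esub> b
        | S a b. a \<in> A \<and> b \<in> B \<and> S \<subseteq> {0<..<1}}"
  have least: "interl I p (A \<union> B) \<subseteq> X" if "internal I p X" "A \<union> B \<subseteq> X" for X
    using that interl_internal_subset[OF lcs] unfolding internal_def by blast
  have D: "internal I p D" "A \<union> B \<subseteq> D"
    using assms(2,4,6) internal_of_mono[of Anet "\<lambda>\<epsilon>. Anet \<epsilon> \<union> Bnet \<epsilon>" I p]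
      internal_of_mono[of Bnet "\<lambda>\<epsilon>. Anet \<epsilon> \<union> Bnet \<epsilon>" I p]
    unfolding internal_def by blast+
  have "D \<subseteq> ?T"
  proof
    fix U assume "U \<in> D"
    then have U: "U \<in> internal_of I p (\<lambda>\<epsilon>. Anet \<epsilon> \<union> Bnet \<epsilon>)" by (simp add: assms(6))
    obtain S a b where "S \<subseteq> {0<..<1}" "a \<in> A" "b \<in> B"
      "U = e_gen S \<odot>\<^bsub>colombeau I p\<^esub> a \<oplus>\<^bsub>colombeau I p\<^esub> e_gen ({0<..<1} - S) \<odot>\<^bsub>colombeau I p\<^esub> b"
      using internal_union_decompose[OF lcs _ _ U] assms(2-5) by blast
    then show "U \<in> ?T" by blast
  qed
  moreover have "?T \<subseteq> interl I p (A \<union> B)"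
  proof -
    have "A \<union> B \<subseteq> carrier (colombeau I p)"
      using assms(2,4) by (auto simp: internal_of_def)
    then show ?thesis using e_gen_pair_in_interl[OF lcs, of _ _ "A \<union> B"] by blast
  qed
  moreover have "interl I p (A \<union> B) \<subseteq> D" using least D by blast
  ultimately show ?thesis using D least by blast
qed

end
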